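(* In a plane $\pi$, let the quadrangles $P_1Q_1R_1S_1$ and $P_2Q_2R_2S_2$ be perspective from a point $O$ of $\pi$. If their diagonal triangles $A_1B_1C_1$ and $A_2B_2C_2$ are also perspective from $O$, then there exists a quadrangle $\overline{P}\,\overline{Q}\,\overline{R}\,\overline{S}$ in a plane $\overline{\pi}\neq\pi$, along with points $O_1\neq O_2$ not in either of the planes $\pi$, $\overline{\pi}$, such that $P_1Q_1R_1S_1$ and $\overline{P}\,\overline{Q}\,\overline{R}\,\overline{S}$ are perspective from $O_1$, and $\overline{P}\,\overline{Q}\,\overline{R}\,\overline{S}$ and $P_2Q_2R_2S_2$ are perspective from $O_2$.
   Context: The setting is three-dimensional projective geometry in the classical synthetic sense of Veblen and Young; in particular any two lines in the same plane have a point of intersection. A quadrangle $PQRS$ in a plane has four vertices $P,Q,R,S$ in that plane, no three of which are collinear. For lines $\ell, m$, $\ell\cdot m$ denotes their intersection. The diagonal triangle $ABC$ of the quadrangle $PQRS$ has as vertices the points in which its opposite sides intersect: $$A = SP\cdot QR,\quad B = SQ\cdot RP,\quad C = SR\cdot PQ.$$ The diagonal points of a quadrangle with decorated vertices carry the same decoration (so $A_i = S_iP_i\cdot Q_iR_i$, $B_i = S_iQ_i\cdot R_iP_i$, $C_i = S_iR_i\cdot P_iQ_i$ for $i=1,2$). Two figures $X_1Y_1Z_1\cdots$ and $X_2Y_2Z_2\cdots$ (triangles or quadrangles, with vertices corresponding in the order written) are perspective from a point $O$ when the lines $X_1X_2$, $Y_1Y_2$, $Z_1Z_2,\ldots$ joining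 corresponding vertices all pass through $O$. No assumption is made on the placement of the two quadrangles beyond those stated; in particular, corresponding vertices or corresponding sides are not assumed to be distinct.
   Formalization: The two quadrangles are assumed not to coincide vertex by vertex (individual corresponding vertices may coincide); if all four corresponding vertices coincide, the claim is false, since three vertices would lie in both planes. *)

theory Defs
  imports Main
begin

text \<open>
  Points are the elements of the type \<open>'p\<close>; lines are sets of points, collected in \<open>L\<close>.
  Planes and three-spaces are the derived notions of Veblen and Young: the plane on a point
  \<open>P\<close> and a line \<open>l\<close> not through \<open>P\<close> consists of the points that are collinear with \<open>P\<close> and some
  point of \<open>l\<close>; a three-space is obtained in the same way from a point and a plane.
\<close>

definition collinear :: "'p set set \<Rightarrow> 'p \<Rightarrow> 'p \<Rightarrow> 'p \<Rightarrow> bool" where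
  "collinear L X Y Z \<longleftrightarrow> (\<exists>l\<in>L. X \<in> l \<and> Y \<in> l \<and> Z \<in> l)"

definition cone :: "'p set set \<Rightarrow> 'p \<Rightarrow> 'p set \<Rightarrow> 'p set" where
  "cone L V F = {X. \<exists>Y\<in>F. collinear L V X Y}"

definition is_plane :: "'p set set \<Rightarrow> 'p set \<Rightarrow> bool" where
  "is_plane L \<pi> \<longleftrightarrow> (\<exists>P l. l \<in> L \<and> P \<notin> l \<and> \<pi> = cone L P l)"

definition is_three_space :: "'p set set \<Rightarrow> 'p set \<Rightarrow> bool" where
  "is_three_space L \<Sigma> \<longleftrightarrow> (\<exists>T \<pi>. is_plane L \<pi> \<and> T \<notin> \<pi> \<and> \<Sigma> = cone L T \<pi>)"

text \<open>
  The axioms of alignment (A) and extension (E) of Veblen and Young for three-dimensional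
  projective geometry.  Their further assumptions (on the diagonal points of a quadrangle, on
  projectivities, and on order and continuity) are not included, so the three diagonal points
  of a quadrangle may be collinear.
\<close>

locale projective_3space =
  fixes L :: "'p set set"
  assumes A1: "X \<noteq> Y \<Longrightarrow> \<exists>l\<in>L. X \<in> l \<and> Y \<in> l"
    and A2: "\<lbrakk>l \<in> L; m \<in> L; X \<noteq> Y; X \<in> l; Y \<in> l; X \<in> m; Y \<in> m\<rbrakk> \<Longrightarrow> l = m"
    and A3: "\<lbrakk>\<not> collinear L A B C; D \<noteq> E; collinear L B C D; collinear L C A E\<rbrakk>
              \<Longrightarrow> \<exists>F. collinear L A B F \<and> collinear L D E F"
    and E0: "l \<in> L \<Longrightarrow> \<exists>X\<in>l. \<exists>Y\<in>l. \<exists>Z\<in>l. X \<noteq> Y \<and> Y \<noteq> Z \<and> X \<noteq> Z"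
    and E1: "L \<noteq> {}"
    and E2: "l \<in> L \<Longrightarrow> \<exists>X. X \<notin> l"
    and E3: "is_plane L \<pi> \<Longrightarrow> \<exists>X. X \<notin> \<pi>"
    and E3': "is_three_space L \<Sigma> \<Longrightarrow> X \<in> \<Sigma>"

text \<open>
  \<open>join L X Y\<close> is meaningful for \<open>X \<noteq> Y\<close>, and \<open>meet l m\<close> for distinct coplanar lines; both
  conditions hold for the sides of a quadrangle and for pairs of opposite sides.
\<close>

definition join :: "'p set set \<Rightarrow> 'p \<Rightarrow> 'p \<Rightarrow> 'p set" where
  "join L X Y = (THE l. l \<in> L \<and> X \<in> l \<and> Y \<in> l)"

definition meet :: "'p set \<Rightarrow> 'p set \<Rightarrow> 'p" where
  "meet l m = (THE X. X \<in> l \<and> X \<in> m)"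

definition quadrangle :: "'p set set \<Rightarrow> 'p set \<Rightarrow> 'p \<Rightarrow> 'p \<Rightarrow> 'p \<Rightarrow> 'p \<Rightarrow> bool" where
  "quadrangle L \<pi> P Q R S \<longleftrightarrow>
     is_plane L \<pi> \<and> P \<in> \<pi> \<and> Q \<in> \<pi> \<and> R \<in> \<pi> \<and> S \<in> \<pi> \<and>
     \<not> collinear L P Q R \<and> \<not> collinear L P Q S \<and> \<not> collinear L P R S \<and> \<not> collinear L Q R S"

definition diagonal_triangle :: "'p set set \<Rightarrow> 'p \<Rightarrow> 'p \<Rightarrow> 'p \<Rightarrow> 'p \<Rightarrow> 'p list" where
  "diagonal_triangle L P Q R S =
     [meet (join L S P) (join L Q R), meet (join L S Q) (join L R P), meet (join L S R) (join L P Q)]"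

text \<open>
  Figures are lists of vertices in corresponding order.  For \<open>X \<noteq> Y\<close>, \<open>collinear L V X Y\<close>
  says that the line \<open>XY\<close> passes through \<open>V\<close>; a pair of coinciding corresponding vertices
  imposes no condition.
\<close>

definition perspective :: "'p set set \<Rightarrow> 'p \<Rightarrow> 'p list \<Rightarrow> 'p list \<Rightarrow> bool" where
  "perspective L V Xs Ys \<longleftrightarrow> list_all2 (collinear L V) Xs Ys"

end

theory Submission
  imports Defs
begin

text \<open>
  Write \<open>V\<close> for the given centre. Choose \<open>O1\<close>, \<open>O2\<close> off \<open>\<pi>\<close> on a line through \<open>V\<close>; for
  \<open>X1\<close>, \<open>X2\<close> in \<open>\<pi>\<close>, distinct from \<open>V\<close> and collinear with it, let \<open>X' = O1X1 \<cdot> O2X2\<close>. If \<open>V\<close> lies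
  neither on \<open>P1Q1\<close> nor on \<open>R1S1\<close>, the planes \<open>O1P1Q1\<close> and \<open>O2P2Q2\<close> are distinct and share
  \<open>P'\<close>, \<open>Q'\<close> and \<open>C'\<close>; likewise \<open>R'\<close>, \<open>S'\<close>, \<open>C'\<close> are collinear. Hence \<open>P'Q'\<close> and \<open>R'S'\<close> meet
  in \<open>C'\<close>, and \<open>P'\<close>, \<open>Q'\<close>, \<open>R'\<close>, \<open>S'\<close> are coplanar. If \<open>V\<close> is a vertex, say \<open>P1\<close>, the condition on
  the diagonal points forces \<open>P2 = V\<close>; then \<open>P'\<close> is only required to lie on the line \<open>O1O2\<close>, and one
  takes its intersection with the plane \<open>Q'R'S'\<close>.
\<close>

section \<open>Collinearity and subspaces\<close>

context projective_3space
begin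

abbreviation col :: "'p \<Rightarrow> 'p \<Rightarrow> 'p \<Rightarrow> bool" where
  "col \<equiv> collinear L"

text \<open>Subspaces of any dimension, so that lines and planes are handled alike.\<close>

definition flat :: "'p set \<Rightarrow> bool" where
  "flat F \<longleftrightarrow> (\<forall>X\<in>F. \<forall>Y\<in>F. \<forall>Z. X \<noteq> Y \<longrightarrow> col X Y Z \<longrightarrow> Z \<in> F)"

lemma flatD: "\<lbrakk>flat F; X \<in> F; Y \<in> F; X \<noteq> Y; col X Y Z\<rbrakk> \<Longrightarrow> Z \<in> F"
  unfolding flat_def by blast

lemma colI: "\<lbrakk>l \<in> L; X \<in> l; Y \<in> l; Z \<in> l\<rbrakk> \<Longrightarrow> col X Y Z"
  unfolding collinear_def by blast

lemma col_in_line: "\<lbrakk>l \<in> L; X \<in> l; Y \<in> l; X \<noteq> Y; col X Y Z\<rbrakk> \<Longrightarrow> Z \<in> l"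
  unfolding collinear_def using A2 by blast

lemma col_swap12: "col X Y Z \<Longrightarrow> col Y X Z"
  unfolding collinear_def by blast

lemma col_swap23: "col X Y Z \<Longrightarrow> col X Z Y"
  unfolding collinear_def by blast

lemma col_commute:
  "col X Y Z = col Y X Z" "col X Y Z = col X Z Y" "col X Y Z = col Z Y X"
  "col X Y Z = col Y Z X" "col X Y Z = col Z X Y"
  unfolding collinear_def by blast+

lemma line_through: "\<exists>l\<in>L. X \<in> l \<and> Y \<in> l"
proof (cases "X = Y")
  case True
  obtain l where "l \<in> L" using E1 by blast
  then obtain Z where "Z \<noteq> X" using E0 by metis
  then show ?thesis using A1[of X Z] True by blast
next
  case False
  then show ?thesis using A1 by blast
qed

lemma col_refl [simp]: "col X X Y" "col X Y X" "col Y X X"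
  using line_through[of X Y] unfolding collinear_def by auto

lemma col_trans: "\<lbrakk>X \<noteq> Y; col X Y Z; col X Y W\<rbrakk> \<Longrightarrow> col X Z W"
  unfolding collinear_def using A2 by blast

lemma flat_line: "l \<in> L \<Longrightarrow> flat l"
  unfolding flat_def using col_in_line by blast

lemma line_subset_flat:
  "\<lbrakk>flat F; l \<in> L; X \<in> l; Y \<in> l; X \<noteq> Y; X \<in> F; Y \<in> F\<rbrakk> \<Longrightarrow> l \<subseteq> F"
  using flatD colI by blast

lemma line_two_points: "l \<in> L \<Longrightarrow> \<exists>X\<in>l. \<exists>Y\<in>l. X \<noteq> Y"
  using E0 by blast

lemma line_other_point: "l \<in> L \<Longrightarrow> \<exists>X\<in>l. X \<noteq> Y"
  using E0 by metis

section \<open>Cones and planes\<close>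

lemma apex_in_cone: "F \<noteq> {} \<Longrightarrow> V \<in> cone L V F"
  unfolding cone_def by auto

lemma base_subset_cone: "F \<subseteq> cone L V F"
  unfolding cone_def using col_refl(3) by blast

lemma cone_subset_flat: "\<lbrakk>flat F; V \<in> F; G \<subseteq> F; V \<notin> G\<rbrakk> \<Longrightarrow> cone L V G \<subseteq> F"
  using flatD[of F V] col_swap23 unfolding cone_def by fastforce

text \<open>Two applications of A3, Veblen's form of the Pasch axiom, push a point \<open>Z\<close>
  of the line \<open>XY\<close> down to \<open>F\<close>: unless \<open>V\<close>, \<open>X\<close>,
  \<open>Y\<close> are collinear, the ray \<open>VZ\<close> meets the line joining the traces
  \<open>X'\<close>, \<open>Y'\<close> of \<open>X\<close>, \<open>Y\<close> in
  \<open>F\<close>.\<close>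

lemma flat_cone:
  assumes F: "flat F" and V: "V \<notin> F"
  shows "flat (cone L V F)"
  unfolding flat_def
proof (intro ballI allI impI)
  fix X Y Z
  assume X: "X \<in> cone L V F" and Y: "Y \<in> cone L V F" and XY: "X \<noteq> Y" and Z: "col X Y Z"
  obtain X' where X': "X' \<in> F" "col V X X'" using X unfolding cone_def by blast
  obtain Y' where Y': "Y' \<in> F" "col V Y Y'" using Y unfolding cone_def by blast
  have "\<exists>W\<in>F. col V Z W"
  proof (cases "col V X Y")
    case True
    then obtain l where l: "l \<in> L" "V \<in> l" "X \<in> l" "Y \<in> l" unfolding collinear_def by blast
    have "Z \<in> l" using l XY Z col_in_line by blast
    moreover have "X' \<in> l \<or> Y' \<in> l" using l XY X' Y' col_in_line by metis
    ultimately show ?thesis using l X' Y' colI by blast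
  next
    case nc: False
    have VX': "V \<noteq> X'" and VY': "V \<noteq> Y'" using V X' Y' by auto
    have XY': "X' \<noteq> Y'"
    proof
      assume "X' = Y'"
      then have "col V X Y" using X' Y' VX' by (metis col_trans col_swap23)
      then show False using nc by simp
    qed
    show ?thesis
    proof (cases "Z = X'")
      case True
      then show ?thesis using X' col_refl(3) by blast
    next
      case False
      \<comment> \<open>The line \<open>ZX'\<close> meets the sides \<open>XY\<close> and
        \<open>XV\<close> of the triangle \<open>VYX\<close> in \<open>Z\<close> and
        \<open>X'\<close>, hence also the side \<open>VY\<close>.\<close>
      have "\<exists>T. col V Y T \<and> col Z X' T"
        by (rule A3[of V Y X]) (use nc False X' Z col_commute in metis)+
      then obtain T where T: "col V Y T" "col Z X' T" by blast
      have VYT: "col Y' T V"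
        using T Y' nc by (metis col_trans col_commute col_refl)
      show ?thesis
      proof (cases "col X' Y' T")
        case True
        have "T = Y'"
        proof (rule ccontr)
          assume "T \<noteq> Y'"
          then have "T \<in> F" using flatD[OF F X'(1) Y'(1) XY' True] by simp
          then have "V \<in> F" using flatD[OF F Y'(1) _ _ VYT] \<open>T \<noteq> Y'\<close> by metis
          then show False using V by simp
        qed
        then have "col X' Y' Z" using T col_commute by metis
        then have "Z \<in> F" using flatD[OF F X'(1) Y'(1) XY'] by simp
        then show ?thesis using col_refl(3) by blast
      next
        case nc2: False
        have "V \<noteq> Z" using nc Z col_commute by metis
        \<comment> \<open>Now the triangle is \<open>X'Y'T\<close>: the line \<open>VZ\<close> meets
          \<open>Y'T\<close> in \<open>V\<close> and \<open>TX'\<close> in \<open>Z\<close>, so it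
          meets \<open>X'Y'\<close>.\<close>
        then have "\<exists>G. col X' Y' G \<and> col V Z G"
          using A3[OF nc2 _ VYT, of Z] T col_commute by metis
        then show ?thesis using flatD[OF F X'(1) Y'(1) XY'] by blast
      qed
    qed
  qed
  then show "Z \<in> cone L V F" unfolding cone_def by simp
qed

lemma flat_plane: "is_plane L E \<Longrightarrow> flat E"
  unfolding is_plane_def using flat_cone flat_line by blast

lemma line_meets_base:
  assumes l: "l \<in> L" and P: "P \<notin> l" and m: "m \<in> L" "m \<subseteq> cone L P l"
  shows "\<exists>X. X \<in> m \<and> X \<in> l"
proof (cases "P \<in> m")
  case True
  obtain X where X: "X \<in> m" "X \<noteq> P" using line_other_point m by blast
  then obtain Y where "Y \<in> l" "col P X Y" using m unfolding cone_def by blast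
  then show ?thesis using col_in_line X m True by metis
next
  case False
  obtain X Y where XY: "X \<in> m" "Y \<in> m" "X \<noteq> Y" using line_two_points m by blast
  obtain X' where X': "X' \<in> l" "col P X X'" using XY m unfolding cone_def by blast
  obtain Y' where Y': "Y' \<in> l" "col P Y Y'" using XY m unfolding cone_def by blast
  have nc: "\<not> col X Y P" using col_in_line[OF m(1)] XY False by metis
  have ne: "Y' \<noteq> X'"
  proof
    assume "Y' = X'"
    then have "col P X Y" using X' Y' P by (metis col_trans col_swap23)
    then show False using nc col_commute by metis
  qed
  have "\<exists>T. col X Y T \<and> col Y' X' T"
    by (rule A3[OF nc ne]) (use X' Y' col_commute in metis)+
  then obtain T where T: "col X Y T" "col Y' X' T" by blast
  then have "T \<in> m" "T \<in> l" using col_in_line m l XY X' Y' ne by metis+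
  then show ?thesis by blast
qed

text \<open>Change of base line: \<open>m\<close> meets the old base \<open>l\<close> in some
  \<open>M\<close>, and a second point \<open>Q\<close> of \<open>l\<close> serves as the new apex.
  The cone over \<open>m\<close> then contains \<open>l\<close> and, by a line joining
  \<open>m\<close> to \<open>l\<close>, also \<open>P\<close>; flatness gives both
  inclusions.\<close>

lemma plane_as_cone:
  assumes E: "is_plane L E" and m: "m \<in> L" "m \<subseteq> E"
  shows "\<exists>Q. Q \<notin> m \<and> E = cone L Q m"
proof -
  obtain P l where Pl: "l \<in> L" "P \<notin> l" "E = cone L P l" using E unfolding is_plane_def by blast
  show ?thesis
  proof (cases "m = l")
    case True
    then show ?thesis using Pl by blast
  next
    case False
    obtain M where M: "M \<in> m" "M \<in> l" using line_meets_base Pl m by metis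
    obtain Q where Q: "Q \<in> l" "Q \<noteq> M" using line_other_point Pl by blast
    obtain R where R: "R \<in> m" "R \<noteq> M" using line_other_point m by blast
    have Qm: "Q \<notin> m" and Rl: "R \<notin> l" using A2 M Q R Pl(1) m(1) False by blast+
    have fl: "flat (cone L Q m)" using flat_cone flat_line Qm m by blast
    have "m \<subseteq> cone L Q m" by (rule base_subset_cone)
    have Qin: "Q \<in> cone L Q m" using apex_in_cone M by blast
    have lsub: "l \<subseteq> cone L Q m"
      using line_subset_flat[OF fl Pl(1) Q(1) M(2) Q(2) Qin] \<open>m \<subseteq> cone L Q m\<close> M by blast
    have "R \<in> E" using R m by blast
    then obtain R' where R': "R' \<in> l" "col P R R'" using Pl unfolding cone_def by blast
    have "P \<in> cone L Q m"
      using flatD[OF fl, of R R' P] R R' Rl lsub \<open>m \<subseteq> cone L Q m\<close> col_commute by (metis subsetD)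
    then have "E \<subseteq> cone L Q m" using cone_subset_flat[OF fl _ lsub] Pl by blast
    moreover have "cone L Q m \<subseteq> E"
      using cone_subset_flat[OF flat_plane[OF E] _ m(2) Qm] Q Pl base_subset_cone by blast
    ultimately show ?thesis using Qm by blast
  qed
qed

lemma coplanar_lines_meet:
  assumes "is_plane L E" "l \<in> L" "l \<subseteq> E" "m \<in> L" "m \<subseteq> E"
  shows "\<exists>X. X \<in> l \<and> X \<in> m"
proof -
  obtain Q where Q: "Q \<notin> m" "E = cone L Q m" using plane_as_cone assms(1,4,5) by blast
  show ?thesis by (rule line_meets_base[OF assms(4) Q(1) assms(2)]) (use assms(3) Q in blast)
qed

text \<open>A line of \<open>E\<close> through \<open>X\<close> meets \<open>m\<close>, as coplanar
  lines do. With apex and base free to choose, a plane is determined by three noncollinear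
  points.\<close>

lemma plane_eq_cone:
  assumes E: "is_plane L E" and m: "m \<in> L" "m \<subseteq> E" and X: "X \<in> E" "X \<notin> m"
  shows "E = cone L X m"
proof
  show "cone L X m \<subseteq> E" by (rule cone_subset_flat[OF flat_plane[OF E] X(1) m(2) X(2)])
  show "E \<subseteq> cone L X m"
  proof
    fix W assume W: "W \<in> E"
    show "W \<in> cone L X m"
    proof (cases "W = X")
      case True
      have "m \<noteq> {}" using line_two_points[OF m(1)] by blast
      then show ?thesis using True apex_in_cone by simp
    next
      case False
      obtain n where n: "n \<in> L" "X \<in> n" "W \<in> n" using line_through by blast
      have "n \<subseteq> E" by (rule line_subset_flat[OF flat_plane[OF E] n False[symmetric] X(1) W])
      then obtain G where G: "G \<in> n" "G \<in> m" using coplanar_lines_meet[OF E n(1) _ m] by metis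
      have "col X W G" by (rule colI[OF n G(1)])
      then show ?thesis unfolding cone_def using G by blast
    qed
  qed
qed

lemma plane_unique:
  assumes "is_plane L E" "is_plane L F" "\<not> col X Y Z"
    and "X \<in> E" "Y \<in> E" "Z \<in> E" "X \<in> F" "Y \<in> F" "Z \<in> F"
  shows "E = F"
proof -
  obtain m where m: "m \<in> L" "Y \<in> m" "Z \<in> m" using line_through by blast
  have "Y \<noteq> Z" using assms(3) by auto
  have "X \<notin> m" using colI[OF m(1) _ m(2,3)] assms(3) by metis
  have "m \<subseteq> E" by (rule line_subset_flat[OF flat_plane[OF assms(1)] m \<open>Y \<noteq> Z\<close> assms(5,6)])
  have "m \<subseteq> F" by (rule line_subset_flat[OF flat_plane[OF assms(2)] m \<open>Y \<noteq> Z\<close> assms(8,9)])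
  have "E = cone L X m"
    by (rule plane_eq_cone[OF assms(1) m(1) \<open>m \<subseteq> E\<close> assms(4) \<open>X \<notin> m\<close>])
  also have "\<dots> = F"
    by (rule plane_eq_cone[OF assms(2) m(1) \<open>m \<subseteq> F\<close> assms(7) \<open>X \<notin> m\<close>, symmetric])
  finally show ?thesis .
qed

section \<open>Lines and planes in space\<close>

lemma plane_through_line:
  assumes l: "l \<in> L"
  shows "\<exists>E. is_plane L E \<and> l \<subseteq> E \<and> X \<in> E"
proof -
  have *: "is_plane L (cone L P l)" if "P \<notin> l" for P
    unfolding is_plane_def using that l by metis
  have ne: "l \<noteq> {}" using line_two_points[OF l] by blast
  show ?thesis
  proof (cases "X \<in> l")
    case True
    obtain P where "P \<notin> l" using E2 l by metis
    then show ?thesis using *[of P] True base_subset_cone[of l P] by blast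
  next
    case False
    then show ?thesis using *[of X] base_subset_cone[of l X] apex_in_cone[OF ne] by blast
  qed
qed

lemma plane_through_points: "\<exists>E. is_plane L E \<and> X \<in> E \<and> Y \<in> E \<and> Z \<in> E"
proof -
  obtain l where l: "l \<in> L" "X \<in> l" "Y \<in> l" using line_through by blast
  then show ?thesis using plane_through_line[OF l(1), of Z] by blast
qed

text \<open>By \<open>E3'\<close> the three-space generated by \<open>T\<close> and \<open>E\<close>
  is the whole space, so the second point \<open>X\<close> of \<open>l\<close> is collinear with
  \<open>T\<close> and a point of \<open>E\<close>.\<close>

lemma line_meets_plane:
  assumes E: "is_plane L E" and l: "l \<in> L"
  shows "\<exists>X\<in>l. X \<in> E"
proof -
  obtain T X where TX: "T \<in> l" "X \<in> l" "T \<noteq> X" using line_two_points l by blast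
  show ?thesis
  proof (cases "T \<in> E")
    case True
    then show ?thesis using TX by blast
  next
    case False
    then have "is_three_space L (cone L T E)" unfolding is_three_space_def using E by metis
    then have "X \<in> cone L T E" by (rule E3')
    then obtain Y where "Y \<in> E" "col T X Y" unfolding cone_def by blast
    then show ?thesis using col_in_line[OF l TX] by blast
  qed
qed

section \<open>Plane sections of three rays through a point\<close>

lemma center_not_in_section:
  assumes \<pi>: "is_plane L \<pi>" "V \<notin> \<pi>" "X \<in> \<pi>" "Y \<in> \<pi>" "Z \<in> \<pi>" and nc: "\<not> col X Y Z"
    and E: "is_plane L E" "X' \<in> E" "Y' \<in> E" "Z' \<in> E"
    and col: "col V X X'" "col V Y Y'" "col V Z Z'"
    and ne: "X' \<noteq> V" "Y' \<noteq> V" "Z' \<noteq> V"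
  shows "V \<notin> E"
proof
  assume V: "V \<in> E"
  \<comment> \<open>Each ray is determined by \<open>V\<close> and its primed point, so with
    \<open>V\<close> in \<open>E\<close> all three rays lie in \<open>E\<close>.\<close>
  have "X \<in> E" "Y \<in> E" "Z \<in> E"
    using flatD[OF flat_plane[OF E(1)] V] E col ne col_swap23 by metis+
  then have "E = \<pi>" using plane_unique \<pi> E nc by metis
  then show False using V \<pi> by simp
qed

text \<open>Collinear section points would lie in a plane through \<open>V\<close>, contrary to
  \<open>center_not_in_section\<close>.\<close>

lemma section_not_collinear:
  assumes \<pi>: "is_plane L \<pi>" "V \<notin> \<pi>" "X \<in> \<pi>" "Y \<in> \<pi>" "Z \<in> \<pi>" and nc: "\<not> col X Y Z"
    and col: "col V X X'" "col V Y Y'" "col V Z Z'"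
    and ne: "X' \<noteq> V" "Y' \<noteq> V" "Z' \<noteq> V"
  shows "\<not> col X' Y' Z'"
proof
  assume "col X' Y' Z'"
  then obtain l where l: "l \<in> L" "X' \<in> l" "Y' \<in> l" "Z' \<in> l" unfolding collinear_def by blast
  obtain E where E: "is_plane L E" "l \<subseteq> E" "V \<in> E" using plane_through_line[OF l(1)] by blast
  have "V \<notin> E"
    by (rule center_not_in_section[OF \<pi> nc E(1) _ _ _ col ne]) (use E l in blast)+
  then show False using E by simp
qed

lemma plane_point_on_transversal:
  assumes "is_plane L \<pi>" "V \<notin> \<pi>" "X \<in> \<pi>" "Y \<in> \<pi>" "col V X Y"
  shows "X = Y"
  using flatD[OF flat_plane[OF assms(1)], of X Y V] assms col_commute by metis

section \<open>Relabelling of quadrangles and diagonal points\<close>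

definition lifts ::
  "'p set \<Rightarrow> 'p \<Rightarrow> 'p \<Rightarrow> 'p \<Rightarrow> 'p \<Rightarrow> 'p \<Rightarrow> 'p \<Rightarrow> 'p \<Rightarrow> 'p \<Rightarrow> bool" where
  "lifts \<pi> P1 Q1 R1 S1 P2 Q2 R2 S2 \<longleftrightarrow> (\<exists>\<pi>' P' Q' R' S' O1 O2.
     quadrangle L \<pi>' P' Q' R' S' \<and> \<pi>' \<noteq> \<pi> \<and>
     O1 \<noteq> O2 \<and> O1 \<notin> \<pi> \<and> O1 \<notin> \<pi>' \<and> O2 \<notin> \<pi> \<and> O2 \<notin> \<pi>' \<and>
     perspective L O1 [P1, Q1, R1, S1] [P', Q', R', S'] \<and>
     perspective L O2 [P', Q', R', S'] [P2, Q2, R2, S2])"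

lemma quadrangle_rotate: "quadrangle L \<pi> P Q R S \<Longrightarrow> quadrangle L \<pi> Q R S P"
  unfolding quadrangle_def using col_commute by metis

lemma lifts_rotate:
  "lifts \<pi> P1 Q1 R1 S1 P2 Q2 R2 S2 \<Longrightarrow> lifts \<pi> Q1 R1 S1 P1 Q2 R2 S2 P2"
  unfolding lifts_def perspective_def using quadrangle_rotate by simp blast

lemma join_props:
  assumes "X \<noteq> Y"
  shows "join L X Y \<in> L \<and> X \<in> join L X Y \<and> Y \<in> join L X Y"
proof -
  have "\<exists>!l. l \<in> L \<and> X \<in> l \<and> Y \<in> l" using A1[OF assms] A2[OF _ _ assms] by blast
  then show ?thesis unfolding join_def by (rule theI')
qed

text \<open>Noncollinearity makes the two sides distinct lines and coplanarity makes them intersect,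
  so the definite descriptions behind \<open>join\<close> and \<open>meet\<close> denote.\<close>

lemma meet_opposite_sides:
  assumes E: "is_plane L E" "X \<in> E" "Y \<in> E" "Z \<in> E" "W \<in> E"
    and nc: "\<not> col X Y Z" "\<not> col X Z W"
  shows "col X Y (meet (join L X Y) (join L Z W)) \<and> col Z W (meet (join L X Y) (join L Z W))"
proof -
  have ne: "X \<noteq> Y" "Z \<noteq> W" using nc by auto
  let ?l = "join L X Y" and ?m = "join L Z W"
  have l: "?l \<in> L" "X \<in> ?l" "Y \<in> ?l" and m: "?m \<in> L" "Z \<in> ?m" "W \<in> ?m"
    using join_props ne by blast+
  have "?l \<subseteq> E" "?m \<subseteq> E"
    using line_subset_flat[OF flat_plane[OF E(1)]] l m ne E by blast+
  then obtain T where T: "T \<in> ?l" "T \<in> ?m" using coplanar_lines_meet E(1) l m by metis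
  have "?l \<noteq> ?m" using l m nc colI by metis
  then have "\<exists>!T. T \<in> ?l \<and> T \<in> ?m" using T A2[OF l(1) m(1)] by blast
  then have "meet ?l ?m \<in> ?l \<and> meet ?l ?m \<in> ?m" unfolding meet_def by (rule theI')
  then show ?thesis using l m colI by blast
qed

text \<open>Perspectivity of one pair of diagonal points, free of \<open>join\<close> and
  \<open>meet\<close> so that relabelling is immediate. For quadrangles the witnesses are forced,
  opposite sides being distinct lines.\<close>

definition diag_persp ::
  "'p \<Rightarrow> 'p \<Rightarrow> 'p \<Rightarrow> 'p \<Rightarrow> 'p \<Rightarrow> 'p \<Rightarrow> 'p \<Rightarrow> 'p \<Rightarrow> 'p \<Rightarrow> bool" where
  "diag_persp V X1 Y1 Z1 W1 X2 Y2 Z2 W2 \<longleftrightarrow> (\<exists>D1 D2.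
     col X1 Y1 D1 \<and> col Z1 W1 D1 \<and> col X2 Y2 D2 \<and> col Z2 W2 D2 \<and> col V D1 D2)"

lemma diag_persp_swap_first:
  "diag_persp V X1 Y1 Z1 W1 X2 Y2 Z2 W2 \<Longrightarrow> diag_persp V Y1 X1 Z1 W1 Y2 X2 Z2 W2"
  unfolding diag_persp_def using col_swap12 by blast

lemma diag_persp_swap_sides:
  "diag_persp V X1 Y1 Z1 W1 X2 Y2 Z2 W2 \<Longrightarrow> diag_persp V Z1 W1 X1 Y1 Z2 W2 X2 Y2"
  unfolding diag_persp_def by blast

lemma diag_persp_swap_second:
  "diag_persp V X1 Y1 Z1 W1 X2 Y2 Z2 W2 \<Longrightarrow> diag_persp V X1 Y1 W1 Z1 X2 Y2 W2 Z2"
  unfolding diag_persp_def using col_swap12 by blast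

lemma diag_persp_reverse:
  "diag_persp V X1 Y1 Z1 W1 X2 Y2 Z2 W2 \<Longrightarrow> diag_persp V X2 Y2 Z2 W2 X1 Y1 Z1 W1"
  unfolding diag_persp_def using col_swap23 by blast

text \<open>With \<open>P1 = V\<close> the side \<open>S1P1\<close> is the line \<open>VS1\<close>;
  it carries \<open>S2\<close> and \<open>A1\<close>, and, as \<open>A1 \<noteq> V\<close>, also
  \<open>A2\<close>. Since \<open>S2\<close> is not on \<open>Q2R2\<close>, the points
  \<open>S2\<close> and \<open>A2\<close> differ, so \<open>P2\<close> is on this line too.\<close>

lemma side_through_center:
  assumes nc1: "\<not> col P1 S1 Q1" "\<not> col P1 Q1 R1" and nc2: "\<not> col S2 Q2 R2"
    and V: "P1 = V" "col V S1 S2"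
    and d: "diag_persp V S1 P1 Q1 R1 S2 P2 Q2 R2"
  shows "col V S2 P2"
proof -
  obtain A1 A2 where A: "col S1 P1 A1" "col Q1 R1 A1" "col S2 P2 A2" "col Q2 R2 A2" "col V A1 A2"
    using d unfolding diag_persp_def by blast
  have "A1 \<noteq> V" using A nc1 V col_commute by metis
  have "S1 \<noteq> V" using nc1 V by auto
  then obtain l where l: "l \<in> L" "V \<in> l" "S1 \<in> l" using A1 by blast
  have "S2 \<in> l" using col_in_line[OF l(1,2,3)] \<open>S1 \<noteq> V\<close> V by metis
  have "A1 \<in> l" using col_in_line[OF l(1,3,2)] \<open>S1 \<noteq> V\<close> V A by metis
  then have "A2 \<in> l" using col_in_line[OF l(1,2)] \<open>A1 \<noteq> V\<close> A by metis
  have "A2 \<noteq> S2" using A nc2 col_commute by metis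
  then have "P2 \<in> l" using col_in_line[OF l(1) \<open>S2 \<in> l\<close> \<open>A2 \<in> l\<close>] A col_swap23 by metis
  then show ?thesis using l \<open>S2 \<in> l\<close> colI by blast
qed

end

section \<open>Two perspective quadrangles and their symmetries\<close>

locale perspective_quadrangles = projective_3space L
  for L :: "'p set set" +
  fixes \<pi> :: "'p set" and V P1 Q1 R1 S1 P2 Q2 R2 S2 :: 'p
  assumes q1: "quadrangle L \<pi> P1 Q1 R1 S1" and q2: "quadrangle L \<pi> P2 Q2 R2 S2"
    and distinct: "(P1, Q1, R1, S1) \<noteq> (P2, Q2, R2, S2)"
    and V: "V \<in> \<pi>"
    and cP: "collinear L V P1 P2" and cQ: "collinear L V Q1 Q2"
    and cR: "collinear L V R1 R2" and cS: "collinear L V S1 S2"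
    and dA: "diag_persp V S1 P1 Q1 R1 S2 P2 Q2 R2"
    and dB: "diag_persp V S1 Q1 R1 P1 S2 Q2 R2 P2"
    and dC: "diag_persp V S1 R1 P1 Q1 S2 R2 P2 Q2"
begin

text \<open>The cyclic shift interchanges the diagonal points \<open>A\<close> and \<open>C\<close>
  and keeps \<open>B\<close>. It allows later arguments to single out the vertex \<open>P\<close> or
  the sides \<open>PQ\<close>, \<open>RS\<close>.\<close>

lemma rotated: "perspective_quadrangles L \<pi> V Q1 R1 S1 P1 Q2 R2 S2 P2"
proof unfold_locales
  show "diag_persp V P1 Q1 R1 S1 P2 Q2 R2 S2"
    by (rule diag_persp_swap_second[OF diag_persp_swap_sides[OF dC]])
  show "diag_persp V P1 R1 S1 Q1 P2 R2 S2 Q2"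
    by (rule diag_persp_swap_first[OF diag_persp_swap_sides[OF dB]])
  show "diag_persp V P1 S1 Q1 R1 P2 S2 Q2 R2"
    by (rule diag_persp_swap_first[OF dA])
  show "(Q1, R1, S1, P1) \<noteq> (Q2, R2, S2, P2)" using distinct by auto
qed (rule quadrangle_rotate[OF q1] quadrangle_rotate[OF q2] V cP cQ cR cS)+

lemma reversed: "perspective_quadrangles L \<pi> V P2 Q2 R2 S2 P1 Q1 R1 S1"
proof unfold_locales
  show "diag_persp V S2 P2 Q2 R2 S1 P1 Q1 R1" "diag_persp V S2 Q2 R2 P2 S1 Q1 R1 P1"
    "diag_persp V S2 R2 P2 Q2 S1 R1 P1 Q1"
    using dA dB dC by (auto intro: diag_persp_reverse)
qed (use q1 q2 distinct V cP cQ cR cS col_swap23 in auto)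

lemma plane: "is_plane L \<pi>"
  using q1 unfolding quadrangle_def by blast

lemma in_plane: "P1 \<in> \<pi>" "Q1 \<in> \<pi>" "R1 \<in> \<pi>" "S1 \<in> \<pi>" "P2 \<in> \<pi>" "Q2 \<in> \<pi>" "R2 \<in> \<pi>" "S2 \<in> \<pi>"
  using q1 q2 unfolding quadrangle_def by blast+

lemma nc: "\<not> col P1 Q1 R1" "\<not> col P1 Q1 S1" "\<not> col P1 R1 S1" "\<not> col Q1 R1 S1"
  "\<not> col P2 Q2 R2" "\<not> col P2 Q2 S2" "\<not> col P2 R2 S2" "\<not> col Q2 R2 S2"
  using q1 q2 unfolding quadrangle_def by blast+

text \<open>If \<open>P2\<close> differed from \<open>V\<close>, the sides \<open>S2P2\<close> and
  \<open>R2P2\<close>, both through \<open>V\<close>, would be the same line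
  \<open>VP2\<close>.\<close>

lemma vertex_at_center_fixed:
  assumes "P1 = V" shows "P2 = V"
proof (rule ccontr)
  assume ne: "P2 \<noteq> V"
  have "col V S2 P2"
    by (rule side_through_center[of P1 S1 Q1 R1 S2 Q2 R2])
      (use nc assms cS dA col_commute in metis)+
  moreover have "col V R2 P2"
    by (rule side_through_center[of P1 R1 Q1 S1 R2 Q2 S2])
      (use nc assms cR diag_persp_swap_second[OF diag_persp_swap_sides[OF dB]] col_commute in metis)+
  ultimately have "col P2 R2 S2" using ne by (metis col_trans col_commute)
  then show False using nc by simp
qed

lemma vertex_at_center_iff: "P1 = V \<longleftrightarrow> P2 = V"
proof -
  interpret r: perspective_quadrangles L \<pi> V P2 Q2 R2 S2 P1 Q1 R1 S1 by (rule reversed)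
  show ?thesis using vertex_at_center_fixed r.vertex_at_center_fixed by blast
qed

end

section \<open>Lifting points and lines out of the plane\<close>

context projective_3space
begin

lemma two_centers:
  assumes \<pi>: "is_plane L \<pi>" "V \<in> \<pi>"
  shows "\<exists>O1 O2. O1 \<noteq> O2 \<and> O1 \<notin> \<pi> \<and> O2 \<notin> \<pi> \<and> col V O1 O2"
proof -
  obtain O1 where O1: "O1 \<notin> \<pi>" using E3 \<pi> by blast
  then obtain l where l: "l \<in> L" "V \<in> l" "O1 \<in> l" using line_through by blast
  obtain O2 where O2: "O2 \<in> l" "O2 \<noteq> V" "O2 \<noteq> O1" using E0[OF l(1)] by metis
  have "O2 \<notin> \<pi>"
    using line_subset_flat[OF flat_plane[OF \<pi>(1)] l(1) O2(1) l(2) O2(2)] O1 l \<pi> by blast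
  then show ?thesis using O1 O2 l colI by blast
qed

text \<open>A3 for the triangle \<open>O1 X1 V\<close>: the line \<open>X2O2\<close> meets
  \<open>X1V\<close> and \<open>VO1\<close>, hence \<open>O1X1\<close>. The last conjunct serves to
  show that the lifted plane is not \<open>\<pi>\<close>.\<close>

lemma lift_point:
  assumes \<pi>: "is_plane L \<pi>" "V \<in> \<pi>" "X1 \<in> \<pi>" "X2 \<in> \<pi>"
    and O: "O1 \<noteq> O2" "O1 \<notin> \<pi>" "O2 \<notin> \<pi>" "col V O1 O2"
    and X: "X1 \<noteq> V" "X2 \<noteq> V" "col V X1 X2"
  shows "\<exists>X'. col O1 X1 X' \<and> col O2 X' X2 \<and> X' \<noteq> O1 \<and> X' \<noteq> O2 \<and> (X' \<in> \<pi> \<longrightarrow> X1 = X2)"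
proof -
  have nc: "\<not> col O1 X1 V" using plane_point_on_transversal \<pi> O X by metis
  have ne: "X2 \<noteq> O2" using \<pi> O by auto
  have "\<exists>F. col O1 X1 F \<and> col X2 O2 F"
    by (rule A3[OF nc ne]) (use X O col_commute in metis)+
  then obtain F where F: "col O1 X1 F" "col O2 F X2" using col_commute by metis
  have "F \<noteq> O1"
  proof
    assume "F = O1"
    \<comment> \<open>This puts \<open>X2\<close> on the line \<open>O1O2\<close>, whose only point
      in \<open>\<pi>\<close> is \<open>V\<close>.\<close>
    then have "col O1 V X2" using F O by (metis col_trans col_commute)
    then show False using plane_point_on_transversal[OF \<pi>(1) O(2) \<pi>(2,4)] X by simp
  qed
  moreover have "F \<noteq> O2"
  proof
    assume "F = O2"
    then have "col O2 V X1" using F O by (metis col_trans col_commute)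
    then show False using plane_point_on_transversal[OF \<pi>(1) O(3) \<pi>(2,3)] X by simp
  qed
  moreover have "X1 = X2" if "F \<in> \<pi>"
    using plane_point_on_transversal[OF \<pi>(1) O(2) \<pi>(3) that F(1)]
      plane_point_on_transversal[OF \<pi>(1) O(3) that \<pi>(4) F(2)] by simp
  ultimately show ?thesis using F by blast
qed

text \<open>The three lifted points lie both in a plane through \<open>O1\<close>,
  \<open>X1\<close>, \<open>Y1\<close> and in one through \<open>O2\<close>, \<open>X2\<close>,
  \<open>Y2\<close>. Were they not collinear, the planes would coincide and contain
  \<open>O1O2\<close>, hence \<open>V\<close>; a plane through \<open>V\<close>, \<open>X1\<close>,
  \<open>Y1\<close> is \<open>\<pi>\<close>, which misses \<open>O1\<close>.\<close>

lemma lifted_col: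
  assumes \<pi>: "is_plane L \<pi>" "V \<in> \<pi>" "X1 \<in> \<pi>" "Y1 \<in> \<pi>"
    and O: "O1 \<noteq> O2" "O1 \<notin> \<pi>" "col V O1 O2"
    and nV: "\<not> col V X1 Y1"
    and D: "col X1 Y1 D1" "col X2 Y2 D2" "X2 \<noteq> Y2"
    and X': "col O1 X1 X'" "col O2 X' X2"
    and Y': "col O1 Y1 Y'" "col O2 Y' Y2"
    and D': "col O1 D1 D'" "col O2 D' D2"
    and ne: "O1 \<noteq> D1" "O2 \<noteq> X2" "O2 \<noteq> Y2" "O2 \<noteq> D2"
  shows "col X' Y' D'"
proof (rule ccontr)
  assume nc: "\<not> col X' Y' D'"
  obtain E where E: "is_plane L E" "O1 \<in> E" "X1 \<in> E" "Y1 \<in> E"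
    using plane_through_points by blast
  obtain F where F: "is_plane L F" "O2 \<in> F" "X2 \<in> F" "Y2 \<in> F"
    using plane_through_points by blast
  note fE = flatD[OF flat_plane[OF E(1)]] and fF = flatD[OF flat_plane[OF F(1)]]
  have O1ne: "O1 \<noteq> X1" "O1 \<noteq> Y1" using \<pi> O by auto
  have "X1 \<noteq> Y1" using nV by auto
  then have "D1 \<in> E" using fE E D by blast
  then have inE: "X' \<in> E" "Y' \<in> E" "D' \<in> E" using fE E X' Y' D' O1ne ne by blast+
  have "D2 \<in> F" using fF F D by blast
  then have inF: "X' \<in> F" "Y' \<in> F" "D' \<in> F" using fF F X' Y' D' ne col_swap23 by blast+
  have "E = F" using plane_unique[OF E(1) F(1) nc] inE inF by blast
  then have "V \<in> E" using fE[of O1 O2 V] E F O col_commute by metis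
  then have "E = \<pi>" using plane_unique[OF E(1) \<pi>(1) nV] E \<pi> by blast
  then show False using E O by simp
qed

end

section \<open>Lifting the whole quadrangle\<close>

context perspective_quadrangles
begin

text \<open>Reduces both cases to finding coplanar lifts in a plane other than \<open>\<pi>\<close>:
  nondegeneracy, and the centres being off \<open>E\<close>, come from the section lemmas.\<close>

lemma liftsI:
  assumes O: "O1 \<noteq> O2" "O1 \<notin> \<pi>" "O2 \<notin> \<pi>"
    and E: "is_plane L E" "P' \<in> E" "Q' \<in> E" "R' \<in> E" "S' \<in> E"
    and c1: "col O1 P1 P'" "col O1 Q1 Q'" "col O1 R1 R'" "col O1 S1 S'"
    and c2: "col O2 P' P2" "col O2 Q' Q2" "col O2 R' R2" "col O2 S' S2"
    and n1: "P' \<noteq> O1" "Q' \<noteq> O1" "R' \<noteq> O1" "S' \<noteq> O1"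
    and n2: "P' \<noteq> O2" "Q' \<noteq> O2" "R' \<noteq> O2" "S' \<noteq> O2"
    and ne: "E \<noteq> \<pi>"
  shows "lifts \<pi> P1 Q1 R1 S1 P2 Q2 R2 S2"
proof -
  note sec = section_not_collinear[OF plane O(2)]
  have "quadrangle L E P' Q' R' S'"
    unfolding quadrangle_def
    using E sec[OF in_plane(1,2,3) nc(1) c1(1,2,3) n1(1,2,3)]
      sec[OF in_plane(1,2,4) nc(2) c1(1,2,4) n1(1,2,4)]
      sec[OF in_plane(1,3,4) nc(3) c1(1,3,4) n1(1,3,4)]
      sec[OF in_plane(2,3,4) nc(4) c1(2,3,4) n1(2,3,4)] by blast
  moreover have "O1 \<notin> E"
    by (rule center_not_in_section[OF plane O(2) in_plane(1,2,3) nc(1) E(1-4) c1(1-3) n1(1-3)])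
  moreover have "O2 \<notin> E"
    by (rule center_not_in_section[OF plane O(3) in_plane(5,6,7) nc(5) E(1-4) _ _ _ n2(1-3)])
      (use c2 col_swap23 in blast)+
  ultimately show ?thesis
    unfolding lifts_def perspective_def
    using O c1 c2 ne by (intro exI[of _ E] exI[of _ P'] exI[of _ Q'] exI[of _ R'] exI[of _ S']
        exI[of _ O1] exI[of _ O2]) simp
qed

lemma lifts_if_vertex_at_center:
  assumes P1: "P1 = V"
  shows "lifts \<pi> P1 Q1 R1 S1 P2 Q2 R2 S2"
proof -
  have P2: "P2 = V" using P1 vertex_at_center_iff by simp
  obtain O1 O2 where O: "O1 \<noteq> O2" "O1 \<notin> \<pi>" "O2 \<notin> \<pi>" "col V O1 O2"
    using two_centers[OF plane V] by blast
  have ne: "Q1 \<noteq> V" "R1 \<noteq> V" "S1 \<noteq> V" "Q2 \<noteq> V" "R2 \<noteq> V" "S2 \<noteq> V"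
    using nc P1 P2 by auto
  note lift = lift_point[OF plane V _ _ O]
  obtain Q' where Q': "col O1 Q1 Q'" "col O2 Q' Q2" "Q' \<noteq> O1" "Q' \<noteq> O2" "Q' \<in> \<pi> \<Longrightarrow> Q1 = Q2"
    using lift[OF in_plane(2,6) ne(1,4) cQ] by blast
  obtain R' where R': "col O1 R1 R'" "col O2 R' R2" "R' \<noteq> O1" "R' \<noteq> O2" "R' \<in> \<pi> \<Longrightarrow> R1 = R2"
    using lift[OF in_plane(3,7) ne(2,5) cR] by blast
  obtain S' where S': "col O1 S1 S'" "col O2 S' S2" "S' \<noteq> O1" "S' \<noteq> O2" "S' \<in> \<pi> \<Longrightarrow> S1 = S2"
    using lift[OF in_plane(4,8) ne(3,6) cS] by blast
  obtain E where E: "is_plane L E" "Q' \<in> E" "R' \<in> E" "S' \<in> E"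
    using plane_through_points by blast
  have O1E: "O1 \<notin> E"
    by (rule center_not_in_section[OF plane O(2) in_plane(2,3,4) nc(4) E Q'(1) R'(1) S'(1)
          Q'(3) R'(3) S'(3)])
  have O2E: "O2 \<notin> E"
    by (rule center_not_in_section[OF plane O(3) in_plane(6,7,8) nc(8) E _ _ _
          Q'(4) R'(4) S'(4)]) (use Q' R' S' col_swap23 in blast)+
  obtain l where l: "l \<in> L" "V \<in> l" "O1 \<in> l" "O2 \<in> l" using O(4) unfolding collinear_def by blast
  obtain P' where P': "P' \<in> l" "P' \<in> E" using line_meets_plane[OF E(1) l(1)] by blast
  have cP': "col O1 P1 P'" "col O2 P' P2" using l P' P1 P2 colI by blast+
  have nP': "P' \<noteq> O1" "P' \<noteq> O2" using P' O1E O2E by auto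
  \<comment> \<open>As \<open>P1 = P2\<close>, one of the other three pairs has distinct members by
    \<open>distinct\<close>, and its lift is outside \<open>\<pi>\<close>.\<close>
  have "E \<noteq> \<pi>" using distinct P1 P2 E Q' R' S' by blast
  then show ?thesis
    using liftsI[OF O(1-3) E(1) P'(2) E(2-4) cP'(1) Q'(1) R'(1) S'(1) cP'(2) Q'(2) R'(2) S'(2)
        nP'(1) Q'(3) R'(3) S'(3) nP'(2) Q'(4) R'(4) S'(4)] by blast
qed

lemma lifts_if_opposite_sides_avoid_center:
  assumes ne1: "P1 \<noteq> V" "Q1 \<noteq> V" "R1 \<noteq> V" "S1 \<noteq> V"
    and ne2: "P2 \<noteq> V" "Q2 \<noteq> V" "R2 \<noteq> V" "S2 \<noteq> V"
    and nV: "\<not> col V P1 Q1" "\<not> col V R1 S1"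
  shows "lifts \<pi> P1 Q1 R1 S1 P2 Q2 R2 S2"
proof -
  obtain O1 O2 where O: "O1 \<noteq> O2" "O1 \<notin> \<pi>" "O2 \<notin> \<pi>" "col V O1 O2"
    using two_centers[OF plane V] by blast
  obtain C1 C2 where C: "col S1 R1 C1" "col P1 Q1 C1" "col S2 R2 C2" "col P2 Q2 C2" "col V C1 C2"
    using dC unfolding diag_persp_def by blast
  have d: "P1 \<noteq> Q1" "P2 \<noteq> Q2" "R1 \<noteq> S1" "R2 \<noteq> S2" using nc by auto
  have CE: "C1 \<in> \<pi>" "C2 \<in> \<pi>"
    using flatD[OF flat_plane[OF plane]] in_plane d C by blast+
  have C1V: "C1 \<noteq> V" using nV C col_commute by metis
  \<comment> \<open>\<open>V\<close> avoids \<open>P2Q2\<close> as well: the rays from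
    \<open>V\<close> through \<open>P2\<close> and \<open>Q2\<close> carry \<open>P1\<close> and
    \<open>Q1\<close>.\<close>
  have C2V: "C2 \<noteq> V"
  proof
    assume "C2 = V"
    then have "col V P2 Q2" using C col_commute by metis
    then have "col V P1 Q1" using cP cQ ne2 by (metis col_trans col_commute)
    then show False using nV by simp
  qed
  note lift = lift_point[OF plane V _ _ O]
  obtain P' where P': "col O1 P1 P'" "col O2 P' P2" "P' \<noteq> O1" "P' \<noteq> O2" "P' \<in> \<pi> \<Longrightarrow> P1 = P2"
    using lift[OF in_plane(1,5) ne1(1) ne2(1) cP] by blast
  obtain Q' where Q': "col O1 Q1 Q'" "col O2 Q' Q2" "Q' \<noteq> O1" "Q' \<noteq> O2" "Q' \<in> \<pi> \<Longrightarrow> Q1 = Q2"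
    using lift[OF in_plane(2,6) ne1(2) ne2(2) cQ] by blast
  obtain R' where R': "col O1 R1 R'" "col O2 R' R2" "R' \<noteq> O1" "R' \<noteq> O2" "R' \<in> \<pi> \<Longrightarrow> R1 = R2"
    using lift[OF in_plane(3,7) ne1(3) ne2(3) cR] by blast
  obtain S' where S': "col O1 S1 S'" "col O2 S' S2" "S' \<noteq> O1" "S' \<noteq> O2" "S' \<in> \<pi> \<Longrightarrow> S1 = S2"
    using lift[OF in_plane(4,8) ne1(4) ne2(4) cS] by blast
  obtain C' where C': "col O1 C1 C'" "col O2 C' C2"
    using lift[OF CE C1V C2V C(5)] by blast
  have nO: "O1 \<noteq> C1" "O2 \<noteq> P2" "O2 \<noteq> Q2" "O2 \<noteq> R2" "O2 \<noteq> S2" "O2 \<noteq> C2"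
    using O CE in_plane by auto
  have PQC: "col P' Q' C'"
    by (rule lifted_col[OF plane V in_plane(1,2) O(1,2,4) nV(1) C(2,4) d(2) P'(1,2) Q'(1,2) C'
          nO(1,2,3,6)])
  have RSC: "col R' S' C'"
    by (rule lifted_col[OF plane V in_plane(3,4) O(1,2,4) nV(2) _ _ d(4) R'(1,2) S'(1,2) C'
          nO(1,4,5,6)]) (use C col_swap12 in blast)+
  have sec: "\<not> col P' Q' R'"
    by (rule section_not_collinear[OF plane O(2) in_plane(1,2,3) nc(1) P'(1) Q'(1) R'(1)
          P'(3) Q'(3) R'(3)])
  obtain E where E: "is_plane L E" "P' \<in> E" "Q' \<in> E" "R' \<in> E"
    using plane_through_points by blast
  \<comment> \<open>\<open>R'\<close> is not on \<open>P'Q'\<close>, so \<open>C'\<close> is a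
    second point of \<open>E\<close> on the line \<open>R'S'\<close>; this brings \<open>S'\<close>
    into \<open>E\<close>.\<close>
  have "P' \<noteq> Q'" "C' \<noteq> R'" using sec PQC by auto
  then have "C' \<in> E" using flatD[OF flat_plane[OF E(1)]] E PQC by blast
  then have "S' \<in> E"
    using flatD[OF flat_plane[OF E(1)] E(4)] \<open>C' \<noteq> R'\<close> RSC col_swap23 by metis
  have "E \<noteq> \<pi>" using distinct E \<open>S' \<in> E\<close> P' Q' R' S' by blast
  then show ?thesis
    using liftsI[OF O(1-3) E \<open>S' \<in> E\<close> P'(1) Q'(1) R'(1) S'(1) P'(2) Q'(2) R'(2) S'(2)
        P'(3) Q'(3) R'(3) S'(3) P'(4) Q'(4) R'(4) S'(4)] by blast
qed

lemma lifts: "lifts \<pi> P1 Q1 R1 S1 P2 Q2 R2 S2"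
proof -
  \<comment> \<open>Successive shifts put each vertex first; \<open>lifts_rotate\<close>, repeated
    until the cycle of four closes, restores the original labels.\<close>
  interpret r1: perspective_quadrangles L \<pi> V Q1 R1 S1 P1 Q2 R2 S2 P2 by (rule rotated)
  interpret r2: perspective_quadrangles L \<pi> V R1 S1 P1 Q1 R2 S2 P2 Q2 by (rule r1.rotated)
  interpret r3: perspective_quadrangles L \<pi> V S1 P1 Q1 R1 S2 P2 Q2 R2 by (rule r2.rotated)
  show ?thesis
  proof (cases "V \<in> {P1, Q1, R1, S1}")
    case True
    then consider "P1 = V" | "Q1 = V" | "R1 = V" | "S1 = V" by auto
    then show ?thesis
    proof cases
      case 1 then show ?thesis by (rule lifts_if_vertex_at_center)
    next
      case 2 then show ?thesis using r1.lifts_if_vertex_at_center lifts_rotate by blast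
    next
      case 3 then show ?thesis using r2.lifts_if_vertex_at_center lifts_rotate by blast
    next
      case 4 then show ?thesis using r3.lifts_if_vertex_at_center lifts_rotate by blast
    qed
  next
    case False
    then have ne1: "P1 \<noteq> V" "Q1 \<noteq> V" "R1 \<noteq> V" "S1 \<noteq> V" by auto
    then have ne2: "P2 \<noteq> V" "Q2 \<noteq> V" "R2 \<noteq> V" "S2 \<noteq> V"
      using vertex_at_center_iff r1.vertex_at_center_iff r2.vertex_at_center_iff
        r3.vertex_at_center_iff by auto
    text \<open>Non-opposite sides meet in a vertex, so all sides through \<open>V\<close> belong to one opposite
      pair, and the pair \<open>PQ\<close>, \<open>RS\<close> or the pair \<open>QR\<close>, \<open>SP\<close> avoids \<open>V\<close>.\<close>
    have adj: "\<not> (col V X Y \<and> col V X Z)" if "\<not> col X Y Z" "X \<noteq> V" for X Y Z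
      using that by (metis col_trans col_commute)
    show ?thesis
    proof (cases "col V P1 Q1 \<or> col V R1 S1")
      case False
      then show ?thesis using lifts_if_opposite_sides_avoid_center[OF ne1 ne2] by blast
    next
      case True
      have "\<not> col V Q1 R1" "\<not> col V S1 P1"
        using True adj nc ne1 col_commute by metis+
      then have "lifts \<pi> Q1 R1 S1 P1 Q2 R2 S2 P2"
        using r1.lifts_if_opposite_sides_avoid_center ne1 ne2 by blast
      then show ?thesis using lifts_rotate by blast
    qed
  qed
qed

end

section \<open>From \<open>join\<close> and \<open>meet\<close> to the configuration of
  \<open>perspective_quadrangles\<close>\<close>

theorem theorem2:
  fixes L :: "'p set set" and \<pi> :: "'p set"
    and P1 Q1 R1 S1 P2 Q2 R2 S2 O0 :: 'p
  assumes "projective_3space L"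
    and "quadrangle L \<pi> P1 Q1 R1 S1"
    and "quadrangle L \<pi> P2 Q2 R2 S2"
    and "(P1, Q1, R1, S1) \<noteq> (P2, Q2, R2, S2)"
    and "O0 \<in> \<pi>"
    and "perspective L O0 [P1, Q1, R1, S1] [P2, Q2, R2, S2]"
    and "perspective L O0 (diagonal_triangle L P1 Q1 R1 S1) (diagonal_triangle L P2 Q2 R2 S2)"
  shows "\<exists>\<pi>' P' Q' R' S' O1 O2.
           quadrangle L \<pi>' P' Q' R' S' \<and> \<pi>' \<noteq> \<pi> \<and>
           O1 \<noteq> O2 \<and> O1 \<notin> \<pi> \<and> O1 \<notin> \<pi>' \<and> O2 \<notin> \<pi> \<and> O2 \<notin> \<pi>' \<and>
           perspective L O1 [P1, Q1, R1, S1] [P', Q', R', S'] \<and>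
           perspective L O2 [P', Q', R', S'] [P2, Q2, R2, S2]"
proof -
  interpret projective_3space L by fact
  have diag: "col S P (meet (join L S P) (join L Q R)) \<and> col Q R (meet (join L S P) (join L Q R))"
      "col S Q (meet (join L S Q) (join L R P)) \<and> col R P (meet (join L S Q) (join L R P))"
      "col S R (meet (join L S R) (join L P Q)) \<and> col P Q (meet (join L S R) (join L P Q))"
    if "quadrangle L \<pi> P Q R S" for P Q R S
    using that unfolding quadrangle_def by (metis meet_opposite_sides col_commute)+
  have persp: "col O0 (meet (join L S1 P1) (join L Q1 R1)) (meet (join L S2 P2) (join L Q2 R2))"
      "col O0 (meet (join L S1 Q1) (join L R1 P1)) (meet (join L S2 Q2) (join L R2 P2))"
      "col O0 (meet (join L S1 R1) (join L P1 Q1)) (meet (join L S2 R2) (join L P2 Q2))"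
    using assms(7) unfolding perspective_def diagonal_triangle_def by auto
  interpret perspective_quadrangles L \<pi> O0 P1 Q1 R1 S1 P2 Q2 R2 S2
  proof unfold_locales
    show "diag_persp O0 S1 P1 Q1 R1 S2 P2 Q2 R2" "diag_persp O0 S1 Q1 R1 P1 S2 Q2 R2 P2"
      "diag_persp O0 S1 R1 P1 Q1 S2 R2 P2 Q2"
      unfolding diag_persp_def using diag[OF assms(2)] diag[OF assms(3)] persp by blast+
  qed (use assms in \<open>auto simp: perspective_def\<close>)
  show ?thesis using lifts unfolding lifts_def .
qed

end
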